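(* Let $k\in\mathbb{N}$ and $a_1,\dots,a_k\in\mathbb{N}$, and let $A_\pi:\Lambda_k\to\bigoplus_{\mathbb{N}}\mathbb{Z}$, $A_\pi(e_\alpha)=a_1e_{\alpha_1}+\cdots+a_ke_{\alpha_k}$, be the linearization of the width-$k$ monomial map $\pi:y_\alpha\mapsto x_{\alpha_1}^{a_1}\cdots x_{\alpha_k}^{a_k}$. Then the lattice $\ker(A_\pi)$ has an equivariant lattice generating set consisting of $(k^2+k-2)/2$ elements of width $k+2$.
   Context: $\mathbb{N}=\{1,2,\dots\}$ and $[n]=\{1,\dots,n\}$. The map $\pi$ goes from the polynomial ring $K[y_\alpha\mid\alpha\in\mathbb{N}^k,\ \alpha_1,\dots,\alpha_k\text{ pairwise distinct}]$ to $K[x_i\mid i\in\mathbb{N}]$, where $K$ is a ring. $\Lambda_k$ denotes the free abelian group with basis $\{e_\alpha : \alpha=(\alpha_1,\dots,\alpha_k)\in\mathbb{N}^k,\ \alpha_1,\dots,\alpha_k \text{ pairwise distinct}\}$. $\bigoplus_{\mathbb{N}}\mathbb{Z}$ has standard basis $e_i$, $i\in\mathbb{N}$. $S_\infty$ is the group of all bijections $\mathbb{N}\to\mathbb{N}$; it acts on $\Lambda_k$ by $\sigma(e_{\alpha_1\dots\alpha_k})=e_{\sigma(\alpha_1)\dots\sigma(\alpha_k)}$. A subset $V$ of an $S_\infty$-stable subgroup $L\subseteq\Lambda_k$ is an equivariant lattice generating set of $L$ if the $S_\infty$-orbits of the elements of $V$ generate $L$ as an abelian group. The width of an element $v\in\Lambda_k$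 is the least $n$ such that some element of its $S_\infty$-orbit is an integer combination of basis vectors $e_\alpha$ with all $\alpha_j\in[n]$. *)

theory Defs
  imports "HOL-Algebra.Free_Abelian_Groups" "HOL-Combinatorics.Permutations"
begin

text \<open>The positive integers are the set \<open>{1..}\<close> of type \<^typ>\<open>nat\<close>, and a tuple
  \<open>(\<alpha>\<^sub>1, \<dots>, \<alpha>\<^sub>k)\<close> is a list of length \<open>k\<close>, so that \<open>\<alpha>\<^sub>j\<close> is \<open>\<alpha> ! (j - 1)\<close>.\<close>

definition tuples :: "nat \<Rightarrow> nat list set" where
  "tuples k = {\<alpha>. length \<alpha> = k \<and> distinct \<alpha> \<and> set \<alpha> \<subseteq> {1..}}"

definition Lambda :: "nat \<Rightarrow> (nat list \<Rightarrow>\<^sub>0 int) monoid" where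
  "Lambda k = free_Abelian_group (tuples k)"

definition A_pi :: "nat list \<Rightarrow> (nat list \<Rightarrow>\<^sub>0 int) \<Rightarrow> (nat \<Rightarrow>\<^sub>0 int)" where
  "A_pi a = frag_extend (\<lambda>\<alpha>. \<Sum>j<length a. frag_cmul (int (a ! j)) (frag_of (\<alpha> ! j)))"

definition act :: "(nat \<Rightarrow> nat) \<Rightarrow> (nat list \<Rightarrow>\<^sub>0 int) \<Rightarrow> (nat list \<Rightarrow>\<^sub>0 int)" where
  "act \<sigma> = frag_extend (\<lambda>\<alpha>. frag_of (map \<sigma> \<alpha>))"

text \<open>The infinite symmetric group consists of all \<open>\<sigma>\<close> with \<^prop>\<open>\<sigma> permutes {1..}\<close>;
  such a \<open>\<sigma>\<close> need not have finite support, and it fixes the unused value \<open>0\<close>.\<close>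

definition orbit_S_inf :: "(nat list \<Rightarrow>\<^sub>0 int) \<Rightarrow> (nat list \<Rightarrow>\<^sub>0 int) set" where
  "orbit_S_inf v = {act \<sigma> v | \<sigma>. \<sigma> permutes {1..}}"

text \<open>Here \<open>L\<close> is meant to be a subgroup of \<open>\<Lambda>\<^sub>k\<close> stable under the action.\<close>

definition equivariant_lattice_generating_set ::
    "nat \<Rightarrow> (nat list \<Rightarrow>\<^sub>0 int) set \<Rightarrow> (nat list \<Rightarrow>\<^sub>0 int) set \<Rightarrow> bool" where
  "equivariant_lattice_generating_set k L V \<longleftrightarrow>
     V \<subseteq> L \<and> generate (Lambda k) (\<Union>v\<in>V. orbit_S_inf v) = L"

text \<open>The carrier of \<^term>\<open>free_Abelian_group S\<close> is the set of integer combinations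
  of the basis vectors indexed by \<open>S\<close>.\<close>

definition width :: "nat \<Rightarrow> (nat list \<Rightarrow>\<^sub>0 int) \<Rightarrow> nat" where
  "width k v = (LEAST n. \<exists>w\<in>orbit_S_inf v.
     w \<in> carrier (free_Abelian_group {\<alpha> \<in> tuples k. set \<alpha> \<subseteq> {1..n}}))"

lemma A_pi_basis: "A_pi a (frag_of \<alpha>) = (\<Sum>j<length a. frag_cmul (int (a ! j)) (frag_of (\<alpha> ! j)))"
  by (simp add: A_pi_def)

lemma A_pi_hom:
  assumes "length a = k"
  shows "A_pi a \<in> hom (Lambda k) (free_Abelian_group {1..})"
proof -
  have "A_pi a x \<in> carrier (free_Abelian_group {1..})" if x: "x \<in> carrier (Lambda k)" for x
    unfolding A_pi_def frag_extend_def
  proof (rule sum_closed_free_Abelian_group)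
    fix \<alpha> assume "\<alpha> \<in> Poly_Mapping.keys x"
    with x have "length \<alpha> = k" "set \<alpha> \<subseteq> {1..}"
      by (auto simp: Lambda_def tuples_def)
    then have "(\<Sum>j<length a. frag_cmul (int (a ! j)) (frag_of (\<alpha> ! j)))
        \<in> carrier (free_Abelian_group {1..})"
      using assms
      by (intro sum_closed_free_Abelian_group) (auto dest!: subsetD[OF keys_cmul] dest: nth_mem)
    then show "frag_cmul (poly_mapping.lookup x \<alpha>)
        (\<Sum>j<length a. frag_cmul (int (a ! j)) (frag_of (\<alpha> ! j)))
        \<in> carrier (free_Abelian_group {1..})"
      using keys_cmul by fastforce
  qed
  then show ?thesis
    by (auto simp: hom_def Lambda_def A_pi_def frag_extend_add)
qed

lemma act_basis: "act \<sigma> (frag_of \<alpha>) = frag_of (map \<sigma> \<alpha>)"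
  by (simp add: act_def)

end

theory Submission
  imports Defs
begin

text \<open>
  Write \<open>\<gamma>[i := p]\<close> for the tuple \<open>\<gamma>\<close> with its \<open>i\<close>-th entry replaced by \<open>p\<close>. Two kinds of
  elements of the kernel suffice. A \<^emph>\<open>square\<close> is the alternating sum of the four tuples obtained
  from \<open>\<gamma>\<close> by replacing, or not, the entries at two positions \<open>i\<close> and \<open>j\<close>; it is killed by every
  map that is a sum of functions of the single entries. An \<^emph>\<open>exchange\<close>
  \<open>\<Sum>\<^sub>i c\<^sub>i (e\<^bsub>\<gamma>[i := p]\<^esub> - e\<^bsub>\<gamma>[i := q]\<^esub>)\<close> is sent to \<open>(\<Sum>\<^sub>i a\<^sub>i c\<^sub>i) (e\<^sub>p - e\<^sub>q)\<close>, so it lies in the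
  kernel when \<open>c\<close> is an integer relation of the weights \<open>a\<close>.

  Modulo squares, the effect of changing one entry does not depend on the other entries, so
  \<open>e\<^sub>\<alpha>\<close> is congruent to \<open>e\<^sub>\<gamma> + \<Sum>\<^sub>i (e\<^bsub>\<gamma>[i := \<alpha>\<^sub>i]\<^esub> - e\<^sub>\<gamma>)\<close> whenever \<open>\<gamma>\<close> and \<open>\<alpha>\<close> have no entry in
  common (\<open>frag_of_hybrid_congruence\<close>). Given \<open>x\<close> in the kernel, choose \<open>\<gamma>\<close> and a further label
  \<open>r\<close> outside the labels of \<open>x\<close>, and let \<open>u\<^sub>i p\<close> be the sum of the coefficients of the tuples in
  \<open>x\<close> with \<open>i\<close>-th entry \<open>p\<close>. That \<open>x\<close> lies in the kernel says that \<open>i \<mapsto> u\<^sub>i p\<close> is an integer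
  relation of \<open>a\<close> for every \<open>p\<close>; as the weights are positive, the total coefficient of \<open>x\<close>
  vanishes. Hence \<open>x\<close> is, modulo squares, the sum over \<open>p\<close> of the exchanges of \<open>p\<close> against \<open>r\<close>
  with coefficients \<open>u\<^sub>i p\<close> (\<open>kernel_subset_of_squares_and_exchanges\<close>).

  Up to the action a square is determined by its pair of positions, which gives \<open>k (k - 1) / 2\<close>
  orbits. An exchange is determined by \<open>c\<close> and depends linearly on it, and the relations of \<open>a\<close>
  are generated by \<open>k - 1\<close> of them (\<open>relation_basis\<close>). Together these are \<open>(k\<^sup>2 + k - 2) / 2\<close>
  elements. Each involves the \<open>k\<close> entries of \<open>\<gamma>\<close> and two more labels. In an exchange all
  entries of \<open>\<gamma>\<close> do occur, because a nonzero relation of positive weights has two nonzero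
  entries. So every generator has width \<open>k + 2\<close>.
\<close>

section \<open>Subgroups of a free abelian group\<close>

lemma subgroup_zero:
  "subgroup H (free_Abelian_group S) \<Longrightarrow> 0 \<in> H"
  using subgroup.one_closed by fastforce

lemma subgroup_add:
  "\<lbrakk>subgroup H (free_Abelian_group S); x \<in> H; y \<in> H\<rbrakk> \<Longrightarrow> x + y \<in> H"
  using subgroup.m_closed by fastforce

lemma subgroup_uminus:
  assumes "subgroup H (free_Abelian_group S)" "x \<in> H"
  shows "- x \<in> H"
  using subgroup.m_inv_closed[OF assms] subgroup.subset[OF assms(1)] assms(2)
  by (metis carrier_free_Abelian_group_iff inv_free_Abelian_group subsetD)

lemma subgroup_diff:
  "\<lbrakk>subgroup H (free_Abelian_group S); x \<in> H; y \<in> H\<rbrakk> \<Longrightarrow> x - y \<in> H"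
  using subgroup_add[of H S x "- y"] subgroup_uminus by fastforce

lemma subgroup_sum:
  assumes "subgroup H (free_Abelian_group S)" "\<And>i. i \<in> I \<Longrightarrow> f i \<in> H"
  shows "sum f I \<in> H"
  using assms(2)
  by (induction I rule: infinite_finite_induct)
     (auto simp: subgroup_zero[OF assms(1)] subgroup_add[OF assms(1)])

lemma subgroup_frag_cmul:
  assumes "subgroup H (free_Abelian_group S)" "x \<in> H"
  shows "frag_cmul c x \<in> H"
  by (rule frag_closure_minus_cmul)
     (use assms in \<open>auto intro: subgroup_zero subgroup_diff\<close>)

lemma frag_cmul_sum_left: "frag_cmul (\<Sum>i\<in>I. f i) x = (\<Sum>i\<in>I. frag_cmul (f i) x)"
  by (induction I rule: infinite_finite_induct) (auto simp: frag_cmul_distrib)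

section \<open>The integer relations of a weight vector\<close>

text \<open>
  The induction on \<open>k\<close> adjoins a relation whose last entry is the least positive one that
  occurs; subtracting a multiple of it from any relation leaves a relation of the first
  \<open>k\<close> weights. The triangular shape obtained in this way stands in for linear independence:
  it is what shows below that the relations \<open>b t\<close> are nonzero and pairwise different.
\<close>

lemma relation_basis:
  fixes a :: "nat \<Rightarrow> int"
  assumes "\<And>i. i < k \<Longrightarrow> a i > 0"
  shows "\<exists>b :: nat \<Rightarrow> nat \<Rightarrow> int.
           (\<forall>t\<in>{1..<k}. b t t \<noteq> 0 \<and> (\<forall>j>t. b t j = 0) \<and> (\<Sum>i<k. a i * b t i) = 0) \<and>
           (\<forall>c. (\<Sum>i<k. a i * c i) = 0 \<longrightarrow>
              (\<exists>n. \<forall>i<k. c i = (\<Sum>t\<in>{1..<k}. n t * b t i)))"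
  using assms
proof (induction k)
  case 0
  then show ?case by simp
next
  case (Suc k)
  show ?case
  proof (cases "k = 0")
    case True
    with Suc.prems[of 0] show ?thesis by auto
  next
    case False
    have "\<And>i. i < k \<Longrightarrow> a i > 0" using Suc.prems by simp
    from Suc.IH[OF this] obtain b where
      b: "\<And>t. t \<in> {1..<k} \<Longrightarrow> b t t \<noteq> 0 \<and> (\<forall>j>t. b t j = 0) \<and> (\<Sum>i<k. a i * b t i) = 0"
      and gen: "\<And>c. (\<Sum>i<k. a i * c i) = 0 \<Longrightarrow>
                  \<exists>n. \<forall>i<k. c i = (\<Sum>t\<in>{1..<k}. n t * b t i)"
      by blast
    define R where "R c \<longleftrightarrow> (\<Sum>i<Suc k. a i * c i) = 0" for c :: "nat \<Rightarrow> int"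
    define P where "P d \<longleftrightarrow> d > 0 \<and> (\<exists>c. R c \<and> c k = int d)" for d :: nat
    \<comment> \<open>A positive last entry exists: \<open>a 0\<close> at position \<open>k\<close> is balanced by \<open>- a k\<close> at position \<open>0\<close>.\<close>
    define f where "f = (\<lambda>i::nat. if i = 0 then - a k else if i = k then a 0 else 0)"
    have "(\<Sum>i<k. a i * f i) = (\<Sum>i<k. if i = 0 then - (a 0 * a k) else 0)"
      by (rule sum.cong) (auto simp: f_def)
    also have "\<dots> = - (a 0 * a k)" using False by simp
    finally have "R f" using False by (simp add: R_def f_def)
    moreover have "a 0 > 0" "f k = int (nat (a 0))"
      using Suc.prems[of 0] False by (auto simp: f_def)
    ultimately have "P (nat (a 0))" by (auto simp: P_def)
    then have LP: "P (LEAST d. P d)" by (rule LeastI)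
    define d where "d = (LEAST d. P d)"
    from LP have "d > 0" and "\<exists>c. R c \<and> c k = int d" unfolding P_def d_def by blast+
    then obtain c0 where c0: "R c0" "c0 k = int d" by blast
    \<comment> \<open>A relation constrains only the entries below \<open>Suc k\<close>; the others are cut off.\<close>
    define b' where "b' = b(k := (\<lambda>j. if j \<le> k then c0 j else 0))"
    have b't: "b' t = b t" if "t \<in> {1..<k}" for t using that by (simp add: b'_def)
    have b'k: "b' k j = c0 j" if "j < Suc k" for j using that by (simp add: b'_def)
    show ?thesis
    proof (intro exI[of _ b'] conjI ballI allI impI)
      fix t assume t: "t \<in> {1..<Suc k}"
      show "b' t t \<noteq> 0"
        using t b[of t] c0 \<open>d > 0\<close> by (cases "t = k") (auto simp: b'_def)
      show "b' t j = 0" if "j > t" for j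
        using t b[of t] that by (cases "t = k") (auto simp: b'_def)
      show "(\<Sum>i<Suc k. a i * b' t i) = 0"
      proof (cases "t = k")
        case True
        have "(\<Sum>i<Suc k. a i * b' t i) = (\<Sum>i<Suc k. a i * c0 i)"
          by (rule sum.cong) (auto simp: True b'k)
        then show ?thesis using c0 by (simp only: R_def)
      next
        case False
        then show ?thesis using t b[of t] by (simp add: b't)
      qed
    next
      fix c assume c: "(\<Sum>i<Suc k. a i * c i) = 0"
      define q where "q = c k div int d"
      define r where "r = (\<lambda>i. c i - q * c0 i)"
      have Rr: "R r"
      proof -
        have "(\<Sum>i<Suc k. a i * r i) = (\<Sum>i<Suc k. a i * c i) - q * (\<Sum>i<Suc k. a i * c0 i)"
          by (simp add: r_def sum_distrib_left sum_subtractf algebra_simps)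
        then show ?thesis using c c0 by (simp only: R_def)
      qed
      have rk: "r k = c k mod int d"
        using c0 by (simp add: r_def q_def minus_div_mult_eq_mod)
      \<comment> \<open>A nonzero remainder would contradict the minimality of \<open>d\<close>.\<close>
      have "r k = 0"
      proof (rule ccontr)
        assume "r k \<noteq> 0"
        then have "r k > 0" "r k < int d" using rk \<open>d > 0\<close>
          using pos_mod_sign[of "int d" "c k"] pos_mod_bound[of "int d" "c k"] by linarith+
        then have "P (nat (r k))" "nat (r k) < d" using Rr by (auto simp: P_def)
        then show False unfolding d_def using not_less_Least by blast
      qed
      then have "(\<Sum>i<k. a i * r i) = 0" using Rr by (simp add: R_def)
      from gen[OF this] obtain n where n: "\<And>i. i < k \<Longrightarrow> r i = (\<Sum>t\<in>{1..<k}. n t * b t i)"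
        by blast
      have "c i = (\<Sum>t\<in>{1..<Suc k}. (n(k := q)) t * b' t i)" if i: "i < Suc k" for i
      proof -
        have eq: "(\<Sum>t\<in>{1..<Suc k}. (n(k := q)) t * b' t i) = (\<Sum>t\<in>{1..<k}. n t * b t i) + q * c0 i"
          using False i b'k by (subst sum.atLeastLessThan_Suc) (auto simp: b't intro!: sum.cong)
        show ?thesis
        proof (cases "i = k")
          case True
          have "(\<Sum>t\<in>{1..<k}. n t * b t i) = 0"
            using b True by (intro sum.neutral) auto
          then show ?thesis using eq \<open>r k = 0\<close> True by (simp add: r_def)
        next
          case False
          then show ?thesis using eq n[of i] i by (simp add: r_def)
        qed
      qed
      then show "\<exists>n. \<forall>i<Suc k. c i = (\<Sum>t\<in>{1..<Suc k}. n t * b' t i)" by blast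
    qed
  qed
qed

section \<open>The action and the width\<close>

lemma act_diff: "act \<sigma> (x - y) = act \<sigma> x - act \<sigma> y"
  by (simp add: act_def frag_extend_diff)

lemma act_add: "act \<sigma> (x + y) = act \<sigma> x + act \<sigma> y"
  by (simp add: act_def frag_extend_add)

lemma A_pi_diff: "A_pi a (x - y) = A_pi a x - A_pi a y"
  by (simp add: A_pi_def frag_extend_diff)

lemma A_pi_add: "A_pi a (x + y) = A_pi a x + A_pi a y"
  by (simp add: A_pi_def frag_extend_add)

text \<open>Equivariance of \<open>A_pi\<close>, where a permutation acts on the target by relabelling its basis.\<close>

lemma A_pi_act:
  assumes "Poly_Mapping.keys x \<subseteq> tuples (length a)"
  shows "A_pi a (act \<sigma> x) = frag_extend (\<lambda>i. frag_of (\<sigma> i)) (A_pi a x)"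
  using assms
proof (induction x rule: frag_induction)
  case (one \<alpha>)
  then show ?case
    by (simp add: act_basis A_pi_basis frag_extend_sum frag_extend_cmul tuples_def)
qed (auto simp: act_diff A_pi_diff frag_extend_diff act_def A_pi_def)

lemma keys_act:
  assumes "inj \<sigma>"
  shows "Poly_Mapping.keys (act \<sigma> x) = map \<sigma> ` Poly_Mapping.keys x"
proof
  show "Poly_Mapping.keys (act \<sigma> x) \<subseteq> map \<sigma> ` Poly_Mapping.keys x"
    unfolding act_def using keys_frag_extend by fastforce
next
  have "Poly_Mapping.lookup (act \<sigma> x) (map \<sigma> \<alpha>) = Poly_Mapping.lookup x \<alpha>" for \<alpha>
    using subset_UNIV
    by (induction x rule: frag_induction)
       (auto simp: lookup_minus inj_map_eq_map[OF assms] act_def frag_extend_diff)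
  then show "map \<sigma> ` Poly_Mapping.keys x \<subseteq> Poly_Mapping.keys (act \<sigma> x)"
    by (auto simp: in_keys_iff)
qed

text \<open>
  A permutation preserves the number of labels that occur, so an element with \<open>n\<close> labels
  cannot be moved into fewer than \<open>n\<close> of them.
\<close>

lemma width_eq:
  assumes tup: "Poly_Mapping.keys v \<subseteq> tuples k"
    and lab: "(\<Union>\<alpha>\<in>Poly_Mapping.keys v. set \<alpha>) = {1..n}"
  shows "width k v = n"
  unfolding width_def
proof (rule Least_equality)
  have "act id v = v"
    using frag_expansion[of v] by (simp add: act_def comp_def)
  then have "v \<in> orbit_S_inf v"
    unfolding orbit_S_inf_def using permutes_id by (metis (mono_tags, lifting) mem_Collect_eq)
  moreover have "v \<in> carrier (free_Abelian_group {\<alpha> \<in> tuples k. set \<alpha> \<subseteq> {1..n}})"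
    using tup lab by auto
  ultimately show "\<exists>w\<in>orbit_S_inf v. w \<in> carrier (free_Abelian_group {\<alpha> \<in> tuples k. set \<alpha> \<subseteq> {1..n}})"
    by blast
next
  fix m
  assume "\<exists>w\<in>orbit_S_inf v. w \<in> carrier (free_Abelian_group {\<alpha> \<in> tuples k. set \<alpha> \<subseteq> {1..m}})"
  then obtain \<sigma> where \<sigma>: "\<sigma> permutes {1..}"
    and sub: "Poly_Mapping.keys (act \<sigma> v) \<subseteq> {\<alpha>. set \<alpha> \<subseteq> {1..m}}"
    by (auto simp: orbit_S_inf_def)
  have "inj \<sigma>" using \<sigma> by (rule permutes_inj)
  have "\<sigma> ` {1..n} \<subseteq> {1..m}"
  proof (rule image_subsetI)
    fix i assume "i \<in> {1..n}"
    then obtain \<alpha> where \<alpha>: "\<alpha> \<in> Poly_Mapping.keys v" "i \<in> set \<alpha>"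
      unfolding lab[symmetric] by blast
    then have "map \<sigma> \<alpha> \<in> Poly_Mapping.keys (act \<sigma> v)"
      by (simp add: keys_act[OF \<open>inj \<sigma>\<close>])
    then have "set (map \<sigma> \<alpha>) \<subseteq> {1..m}" using sub by blast
    then show "\<sigma> i \<in> {1..m}" using \<alpha>(2) by (simp add: image_subset_iff)
  qed
  then have "card (\<sigma> ` {1..n}) \<le> card {1..m}" by (intro card_mono) auto
  then show "n \<le> m" using card_image[OF inj_on_subset[OF \<open>inj \<sigma>\<close> subset_UNIV], of "{1..n}"] by simp
qed

lemma ex_permutes_map_eq:
  fixes xs ys :: "'a list"
  assumes "length xs = length ys" "distinct xs" "distinct ys" "set xs \<subseteq> A" "set ys \<subseteq> A"
  shows "\<exists>\<sigma>. \<sigma> permutes A \<and> map \<sigma> xs = ys"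
  using assms
proof (induction xs ys rule: list_induct2)
  case Nil
  then show ?case by (auto intro: permutes_id)
next
  case (Cons x xs y ys)
  then obtain \<sigma> where \<sigma>: "\<sigma> permutes A" "map \<sigma> xs = ys" by auto
  \<comment> \<open>Neither \<open>\<sigma> x\<close> nor \<open>y\<close> occurs in \<open>ys\<close>, so exchanging them does not affect the values on \<open>xs\<close>.\<close>
  have "\<sigma> x \<notin> set ys"
    unfolding \<sigma>(2)[symmetric] using Cons.prems(1) by (auto dest: injD[OF permutes_inj[OF \<sigma>(1)]])
  have "transpose (\<sigma> x) y \<circ> \<sigma> permutes A"
    using \<sigma> Cons.prems by (intro permutes_compose permutes_swap_id) (auto simp: permutes_in_image)
  moreover have "map (transpose (\<sigma> x) y \<circ> \<sigma>) (x # xs) = y # ys"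
  proof -
    have "map (transpose (\<sigma> x) y) ys = ys"
      using \<open>\<sigma> x \<notin> set ys\<close> Cons.prems(2) by (intro map_idI) (auto intro: transpose_apply_other)
    then show ?thesis using \<sigma>(2) by (simp flip: map_map)
  qed
  ultimately show ?case by (intro exI conjI)
qed

section \<open>Squares and exchanges\<close>

text \<open>
  The two kinds of generators. In their intended use \<open>p\<close> and \<open>q\<close> are distinct labels outside
  \<open>\<gamma>\<close>, which for \<open>\<gamma>\<close> of length \<open>k\<close> is expressed by \<open>p # q # \<gamma> \<in> tuples (k + 2)\<close>.
\<close>

definition square :: "nat list \<Rightarrow> nat \<Rightarrow> nat \<Rightarrow> nat \<Rightarrow> nat \<Rightarrow> nat list \<Rightarrow>\<^sub>0 int" where
  "square \<gamma> i j p q =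
     frag_of \<gamma> - frag_of (\<gamma>[i := p]) - frag_of (\<gamma>[j := q]) + frag_of (\<gamma>[i := p, j := q])"

definition exchange :: "(nat \<Rightarrow> int) \<Rightarrow> nat list \<Rightarrow> nat \<Rightarrow> nat \<Rightarrow> nat list \<Rightarrow>\<^sub>0 int" where
  "exchange c \<gamma> p q =
     (\<Sum>i<length \<gamma>. frag_cmul (c i) (frag_of (\<gamma>[i := p]) - frag_of (\<gamma>[i := q])))"

lemma frag_cmul_diff2: "frag_cmul c (x - y) = frag_cmul c x - frag_cmul c y"
  by (rule poly_mapping_eqI) (simp add: lookup_minus algebra_simps)

lemma list_update_in_tuples:
  assumes "\<gamma> \<in> tuples k" "p \<notin> set \<gamma>" "p \<ge> 1"
  shows "\<gamma>[i := p] \<in> tuples k"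
  using assms set_update_subset_insert[of \<gamma> i p]
  by (auto simp: tuples_def intro!: distinct_list_update)

lemma tuples_add_2D:
  assumes "p # q # \<gamma> \<in> tuples (k + 2)"
  shows "\<gamma> \<in> tuples k" "length \<gamma> = k" "p \<notin> set \<gamma>" "q \<notin> set \<gamma>" "p \<noteq> q" "p \<ge> 1" "q \<ge> 1"
  using assms by (auto simp: tuples_def)

lemma notin_set_list_update: "\<lbrakk>q \<notin> set \<gamma>; p \<noteq> q\<rbrakk> \<Longrightarrow> q \<notin> set (\<gamma>[i := p])"
  using set_update_subset_insert[of \<gamma> i p] by auto

lemma keys_square_subset:
  assumes "p # q # \<gamma> \<in> tuples (k + 2)"
  shows "Poly_Mapping.keys (square \<gamma> i j p q) \<subseteq> {\<alpha> \<in> tuples k. set \<alpha> \<subseteq> {p, q} \<union> set \<gamma>}"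
    (is "_ \<subseteq> ?T")
proof -
  note t = tuples_add_2D[OF assms]
  note S = group.subgroup_self[OF group_free_Abelian_group[of ?T]]
  have "set (\<gamma>[i := p]) \<subseteq> {p, q} \<union> set \<gamma>" "set (\<gamma>[j := q]) \<subseteq> {p, q} \<union> set \<gamma>"
    "set (\<gamma>[i := p, j := q]) \<subseteq> {p, q} \<union> set \<gamma>"
    by (intro set_update_subsetI; blast)+
  with t have "\<gamma> \<in> ?T" "\<gamma>[i := p] \<in> ?T" "\<gamma>[j := q] \<in> ?T" "\<gamma>[i := p, j := q] \<in> ?T"
    by (simp_all add: list_update_in_tuples notin_set_list_update subset_insertI2)
  then have "square \<gamma> i j p q \<in> carrier (free_Abelian_group ?T)"
    unfolding square_def
    by (intro subgroup_add[OF S] subgroup_diff[OF S]; simp only: frag_of_in_free_Abelian_group)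
  then show ?thesis by simp
qed

lemma keys_exchange_subset:
  assumes "p # q # \<gamma> \<in> tuples (k + 2)"
  shows "Poly_Mapping.keys (exchange c \<gamma> p q) \<subseteq> {\<alpha> \<in> tuples k. set \<alpha> \<subseteq> {p, q} \<union> set \<gamma>}"
    (is "_ \<subseteq> ?T")
proof -
  note t = tuples_add_2D[OF assms]
  note S = group.subgroup_self[OF group_free_Abelian_group[of ?T]]
  have "set (\<gamma>[i := p]) \<subseteq> {p, q} \<union> set \<gamma>" "set (\<gamma>[i := q]) \<subseteq> {p, q} \<union> set \<gamma>" for i
    by (intro set_update_subsetI; blast)+
  with t have "\<gamma>[i := p] \<in> ?T" "\<gamma>[i := q] \<in> ?T" for i
    by (simp_all add: list_update_in_tuples)
  then have "exchange c \<gamma> p q \<in> carrier (free_Abelian_group ?T)"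
    unfolding exchange_def
    by (intro subgroup_sum[OF S] subgroup_frag_cmul[OF S] subgroup_diff[OF S];
        simp only: frag_of_in_free_Abelian_group)
  then show ?thesis by simp
qed

text \<open>
  Changing one entry changes the image by an amount independent of the other entries; this
  is why squares and exchanges can be evaluated entry by entry.
\<close>

lemma A_pi_list_update:
  assumes "length \<gamma> = length a" "i < length a"
  shows "A_pi a (frag_of (\<gamma>[i := p])) =
           A_pi a (frag_of \<gamma>) + frag_cmul (int (a ! i)) (frag_of p - frag_of (\<gamma> ! i))"
proof -
  let ?g = "frag_cmul (int (a ! i)) (frag_of p - frag_of (\<gamma> ! i))"
  have "A_pi a (frag_of (\<gamma>[i := p])) =
      (\<Sum>j<length a. frag_cmul (int (a ! j)) (frag_of (\<gamma> ! j)) + (if j = i then ?g else 0))"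
    unfolding A_pi_basis using assms
    by (intro sum.cong) (auto simp: nth_list_update frag_cmul_diff2)
  also have "\<dots> = A_pi a (frag_of \<gamma>) + ?g"
    using assms by (simp add: sum.distrib A_pi_basis)
  finally show ?thesis .
qed

lemma A_pi_square:
  assumes "length \<gamma> = length a" "i < length a" "j < length a" "i \<noteq> j"
  shows "A_pi a (square \<gamma> i j p q) = 0"
  using assms by (simp add: square_def A_pi_add A_pi_diff A_pi_list_update del: minus_frag_cmul)

lemma A_pi_exchange:
  assumes "length \<gamma> = length a" "(\<Sum>i<length a. int (a ! i) * c i) = 0"
  shows "A_pi a (exchange c \<gamma> p q) = 0"
proof -
  have "A_pi a (exchange c \<gamma> p q) =
      (\<Sum>i<length a. frag_cmul (c i) (A_pi a (frag_of (\<gamma>[i := p]) - frag_of (\<gamma>[i := q]))))"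
    by (simp add: exchange_def A_pi_def frag_extend_sum frag_extend_cmul assms(1) comp_def)
  also have "\<dots> = (\<Sum>i<length a. frag_cmul (int (a ! i) * c i) (frag_of p - frag_of q))"
  proof (intro sum.cong refl)
    fix i assume "i \<in> {..<length a}"
    then have "A_pi a (frag_of (\<gamma>[i := p]) - frag_of (\<gamma>[i := q])) =
        frag_cmul (int (a ! i)) (frag_of p - frag_of q)"
      using assms by (simp add: A_pi_diff A_pi_list_update frag_cmul_diff2)
    then show "frag_cmul (c i) (A_pi a (frag_of (\<gamma>[i := p]) - frag_of (\<gamma>[i := q]))) =
        frag_cmul (int (a ! i) * c i) (frag_of p - frag_of q)"
      by (simp add: mult.commute)
  qed
  also have "\<dots> = 0"
    by (simp add: assms flip: frag_cmul_sum_left)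
  finally show ?thesis .
qed

lemma act_square:
  "act \<sigma> (square \<gamma> i j p q) = square (map \<sigma> \<gamma>) i j (\<sigma> p) (\<sigma> q)"
  by (simp add: square_def act_add act_diff act_basis map_update)

lemma act_exchange:
  "act \<sigma> (exchange c \<gamma> p q) = exchange c (map \<sigma> \<gamma>) (\<sigma> p) (\<sigma> q)"
  by (simp add: exchange_def act_def frag_extend_sum frag_extend_cmul frag_extend_diff
                map_update comp_def)

lemma square_commute: "i \<noteq> j \<Longrightarrow> square \<gamma> j i q p = square \<gamma> i j p q"
  by (simp add: square_def list_update_swap[of i j])

lemma exchange_sum:
  assumes "\<And>i. i < length \<gamma> \<Longrightarrow> c i = (\<Sum>t\<in>T. n t * b t i)"
  shows "exchange c \<gamma> p q = (\<Sum>t\<in>T. frag_cmul (n t) (exchange (b t) \<gamma> p q))"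
proof -
  have "exchange c \<gamma> p q =
      (\<Sum>i<length \<gamma>. \<Sum>t\<in>T. frag_cmul (n t) (frag_cmul (b t i) (frag_of (\<gamma>[i := p]) - frag_of (\<gamma>[i := q]))))"
    unfolding exchange_def using assms by (simp add: frag_cmul_sum_left)
  then show ?thesis
    by (subst (asm) sum.swap) (simp add: exchange_def frag_cmul_sum)
qed

text \<open>
  For fresh labels the tuples occurring in a square or an exchange are pairwise different, so
  nothing cancels. The coefficients below show which labels occur, and they tell generators
  apart.
\<close>

context
  fixes \<gamma> :: "nat list" and p q :: nat
  assumes fresh: "p \<notin> set \<gamma>" "q \<notin> set \<gamma>" "p \<noteq> q"
begin

lemma list_update_eq_iff:
  assumes "i < length \<gamma>" "l < length \<gamma>"
  shows "\<gamma>[l := p] = \<gamma>[i := p] \<longleftrightarrow> l = i" "\<gamma>[l := q] = \<gamma>[i := q] \<longleftrightarrow> l = i"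
  using assms fresh by (metis nth_list_update_eq nth_list_update_neq nth_mem)+

lemma list_update_neq:
  assumes "i < length \<gamma>" "l < length \<gamma>"
  shows "\<gamma> \<noteq> \<gamma>[i := p]" "\<gamma> \<noteq> \<gamma>[i := q]" "\<gamma>[l := p] \<noteq> \<gamma>[i := q]" "\<gamma>[i := q] \<noteq> \<gamma>[l := p]"
  using assms fresh notin_set_list_update set_update_memI by metis+

lemma list_update_2_neq:
  assumes "i < length \<gamma>" "j < length \<gamma>" "i \<noteq> j"
  shows "\<gamma> \<noteq> \<gamma>[i := p, j := q]" "\<gamma>[l := p] \<noteq> \<gamma>[i := p, j := q]" "\<gamma>[l := q] \<noteq> \<gamma>[i := p, j := q]"
proof -
  have "q \<in> set (\<gamma>[i := p, j := q])" "p \<in> set (\<gamma>[i := p, j := q])"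
    using set_update_memI[of j "\<gamma>[i := p]" q] set_update_memI[of i "\<gamma>[j := q]" p] assms
    by (simp_all add: list_update_swap[of i j])
  moreover have "q \<notin> set (\<gamma>[l := p])" "p \<notin> set (\<gamma>[l := q])"
    using fresh by (simp_all add: notin_set_list_update)
  ultimately show "\<gamma> \<noteq> \<gamma>[i := p, j := q]" "\<gamma>[l := p] \<noteq> \<gamma>[i := p, j := q]"
      "\<gamma>[l := q] \<noteq> \<gamma>[i := p, j := q]"
    using fresh by metis+
qed

lemma lookup_square:
  assumes "i < length \<gamma>" "j < length \<gamma>" "i \<noteq> j"
  shows "Poly_Mapping.lookup (square \<gamma> i j p q) \<gamma> = 1"
    and "l < length \<gamma> \<Longrightarrow> Poly_Mapping.lookup (square \<gamma> i j p q) (\<gamma>[l := p]) = (if l = i then -1 else 0)"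
    and "l < length \<gamma> \<Longrightarrow> Poly_Mapping.lookup (square \<gamma> i j p q) (\<gamma>[l := q]) = (if l = j then -1 else 0)"
  using assms list_update_neq list_update_2_neq list_update_eq_iff
  by (auto simp: square_def lookup_add lookup_minus dest: sym)

lemma lookup_exchange:
  shows "Poly_Mapping.lookup (exchange c \<gamma> p q) \<gamma> = 0"
    and "l < length \<gamma> \<Longrightarrow> Poly_Mapping.lookup (exchange c \<gamma> p q) (\<gamma>[l := p]) = c l"
    and "l < length \<gamma> \<Longrightarrow> Poly_Mapping.lookup (exchange c \<gamma> p q) (\<gamma>[l := q]) = - c l"
proof -
  show "Poly_Mapping.lookup (exchange c \<gamma> p q) \<gamma> = 0"
    using list_update_neq by (simp add: exchange_def lookup_sum lookup_minus)
  assume l: "l < length \<gamma>"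
  have "Poly_Mapping.lookup (exchange c \<gamma> p q) (\<gamma>[l := p]) = (\<Sum>i<length \<gamma>. if i = l then c i else 0)"
    unfolding exchange_def lookup_sum using l list_update_neq list_update_eq_iff
    by (intro sum.cong) (auto simp: lookup_minus)
  then show "Poly_Mapping.lookup (exchange c \<gamma> p q) (\<gamma>[l := p]) = c l"
    using l by simp
  have "Poly_Mapping.lookup (exchange c \<gamma> p q) (\<gamma>[l := q]) = (\<Sum>i<length \<gamma>. if i = l then - c i else 0)"
    unfolding exchange_def lookup_sum using l list_update_neq list_update_eq_iff
    by (intro sum.cong) (auto simp: lookup_minus)
  then show "Poly_Mapping.lookup (exchange c \<gamma> p q) (\<gamma>[l := q]) = - c l"
    using l by simp
qed

lemma labels_square:
  assumes "i < length \<gamma>" "j < length \<gamma>" "i \<noteq> j"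
  shows "{p, q} \<union> set \<gamma> \<subseteq> (\<Union>\<alpha>\<in>Poly_Mapping.keys (square \<gamma> i j p q). set \<alpha>)"
proof -
  have "\<gamma> \<in> Poly_Mapping.keys (square \<gamma> i j p q)"
    "\<gamma>[i := p] \<in> Poly_Mapping.keys (square \<gamma> i j p q)"
    "\<gamma>[j := q] \<in> Poly_Mapping.keys (square \<gamma> i j p q)"
    using assms by (simp_all add: in_keys_iff lookup_square)
  moreover have "p \<in> set (\<gamma>[i := p])" "q \<in> set (\<gamma>[j := q])"
    using assms by (auto intro: set_update_memI)
  ultimately show ?thesis by blast
qed

text \<open>
  Replacing the entry at \<open>i\<close> removes that label from the tuple, so a second position with
  nonzero coefficient is needed for it to occur.
\<close>

lemma labels_exchange:
  assumes "i < length \<gamma>" "j < length \<gamma>" "i \<noteq> j" "c i \<noteq> 0" "c j \<noteq> 0"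
  shows "{p, q} \<union> set \<gamma> \<subseteq> (\<Union>\<alpha>\<in>Poly_Mapping.keys (exchange c \<gamma> p q). set \<alpha>)"
proof -
  have "\<gamma>[i := p] \<in> Poly_Mapping.keys (exchange c \<gamma> p q)"
    "\<gamma>[j := p] \<in> Poly_Mapping.keys (exchange c \<gamma> p q)"
    "\<gamma>[j := q] \<in> Poly_Mapping.keys (exchange c \<gamma> p q)"
    using assms by (simp_all add: in_keys_iff lookup_exchange)
  moreover have "p \<in> set (\<gamma>[i := p])" "q \<in> set (\<gamma>[j := q])"
    using assms by (auto intro: set_update_memI)
  moreover have "set \<gamma> \<subseteq> set (\<gamma>[i := p]) \<union> set (\<gamma>[j := p])"
  proof
    fix x assume "x \<in> set \<gamma>"
    then obtain l where "l < length \<gamma>" "x = \<gamma> ! l" by (auto simp: in_set_conv_nth)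
    then have "x = \<gamma>[i := p] ! l \<or> x = \<gamma>[j := p] ! l"
      using assms(3) by (cases "l = i") auto
    then show "x \<in> set (\<gamma>[i := p]) \<union> set (\<gamma>[j := p])"
      using \<open>l < length \<gamma>\<close> by (metis UnCI length_list_update nth_mem)
  qed
  ultimately show ?thesis by blast
qed

end

section \<open>Generation of the kernel\<close>

text \<open>
  Move from \<open>\<gamma>\<close> to \<open>\<alpha>\<close> through the hybrids \<open>h m\<close>, which agree with \<open>\<alpha>\<close> in the first \<open>m\<close>
  places and with \<open>\<gamma>\<close> afterwards. The step that changes place \<open>m\<close> is compared with the same
  step performed directly on \<open>\<gamma>\<close>: undoing the earlier changes one by one costs a square each
  time.
\<close>

lemma frag_of_hybrid_congruence:
  assumes H: "subgroup H (free_Abelian_group S)"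
    and sq: "\<And>\<gamma> i j p q. \<lbrakk>p # q # \<gamma> \<in> tuples (k + 2); i < k; j < k; i \<noteq> j\<rbrakk> \<Longrightarrow> square \<gamma> i j p q \<in> H"
    and \<alpha>: "\<alpha> \<in> tuples k" and \<gamma>: "\<gamma> \<in> tuples k" and disj: "set \<alpha> \<inter> set \<gamma> = {}"
  shows "frag_of \<alpha> - (frag_of \<gamma> + (\<Sum>i<k. frag_of (\<gamma>[i := \<alpha> ! i]) - frag_of \<gamma>)) \<in> H"
proof -
  define h where "h m = take m \<alpha> @ drop m \<gamma>" for m
  have len: "length \<alpha> = k" "length \<gamma> = k" using \<alpha> \<gamma> by (auto simp: tuples_def)
  have h_Suc: "(h m)[m := \<alpha> ! m] = h (Suc m)" if "m < k" for m
    using that len unfolding h_def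
    by (simp add: list_update_append take_Suc_conv_app_nth flip: Cons_nth_drop_Suc)
  have h_tuples: "\<alpha> ! l # \<alpha> ! m # h l \<in> tuples (k + 2)" if "l < m" "m < k" for l m
  proof -
    have "distinct (take l \<alpha> @ [\<alpha> ! l] @ [\<alpha> ! m])"
      using \<alpha> that len
      by (auto simp: tuples_def in_set_conv_nth nth_eq_iff_index_eq)
    moreover have sub: "set (drop l \<gamma>) \<subseteq> set \<gamma>" "set (take l \<alpha>) \<subseteq> set \<alpha>"
      "\<alpha> ! l \<in> set \<alpha>" "\<alpha> ! m \<in> set \<alpha>"
      using that len by (auto dest: in_set_dropD in_set_takeD)
    moreover from sub disj have "\<alpha> ! l \<notin> set (drop l \<gamma>)" "\<alpha> ! m \<notin> set (drop l \<gamma>)"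
      "set (take l \<alpha>) \<inter> set (drop l \<gamma>) = {}" by blast+
    moreover have "distinct (drop l \<gamma>)" "set \<alpha> \<subseteq> {1..}" "set \<gamma> \<subseteq> {1..}"
      using \<alpha> \<gamma> by (auto simp: tuples_def)
    moreover from this sub have "set (\<alpha> ! l # \<alpha> ! m # h l) \<subseteq> {1..}"
      unfolding h_def set_append list.set by blast
    ultimately show ?thesis
      using len that by (simp add: tuples_def h_def)
  qed
  have inner: "frag_of ((h l)[m := \<alpha> ! m]) - frag_of (h l) - (frag_of (\<gamma>[m := \<alpha> ! m]) - frag_of \<gamma>) \<in> H"
    if "l \<le> m" "m < k" for l m
    using that(1)
  proof (induction l)
    case 0
    then show ?case by (simp add: h_def subgroup_zero[OF H])
  next
    case (Suc l)
    have "square (h l) l m (\<alpha> ! l) (\<alpha> ! m) \<in> H"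
      using Suc.prems that by (intro sq h_tuples) auto
    with Suc have "square (h l) l m (\<alpha> ! l) (\<alpha> ! m) +
        (frag_of ((h l)[m := \<alpha> ! m]) - frag_of (h l) - (frag_of (\<gamma>[m := \<alpha> ! m]) - frag_of \<gamma>)) \<in> H"
      by (intro subgroup_add[OF H]) auto
    moreover have "(h l)[l := \<alpha> ! l] = h (Suc l)" using Suc.prems that by (intro h_Suc) auto
    ultimately show ?case by (simp add: square_def algebra_simps)
  qed
  have "frag_of (h m) - (frag_of \<gamma> + (\<Sum>i<m. frag_of (\<gamma>[i := \<alpha> ! i]) - frag_of \<gamma>)) \<in> H"
    if "m \<le> k" for m
    using that
  proof (induction m)
    case 0
    then show ?case by (simp add: h_def subgroup_zero[OF H])
  next
    case (Suc m)
    from subgroup_add[OF H Suc.IH inner[of m m]] Suc.prems show ?case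
      by (simp add: h_Suc algebra_simps)
  qed
  from this[of k] show ?thesis by (simp add: h_def len)
qed

text \<open>
  The congruence above turns \<open>x\<close> into a combination of the tuples \<open>\<gamma>[i := p]\<close>, in which the
  kernel condition decouples: it says separately for each label \<open>p\<close> that the coefficients at
  \<open>p\<close> form a relation of \<open>a\<close>. The auxiliary label \<open>r\<close> turns each of these parts into an
  exchange; what is left over is a multiple of the total coefficient \<open>d\<close>, which is \<open>0\<close>.
\<close>

lemma kernel_subset_of_squares_and_exchanges:
  assumes a: "length a = k" "k \<ge> 1" "set a \<subseteq> {1..}"
    and H: "subgroup H (free_Abelian_group S)"
    and sq: "\<And>\<gamma> i j p q. \<lbrakk>p # q # \<gamma> \<in> tuples (k + 2); i < k; j < k; i \<noteq> j\<rbrakk> \<Longrightarrow> square \<gamma> i j p q \<in> H"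
    and ex: "\<And>c \<gamma> p q. \<lbrakk>p # q # \<gamma> \<in> tuples (k + 2); (\<Sum>i<k. int (a ! i) * c i) = 0\<rbrakk> \<Longrightarrow> exchange c \<gamma> p q \<in> H"
    and x: "Poly_Mapping.keys x \<subseteq> tuples k" "A_pi a x = 0"
  shows "x \<in> H"
proof -
  let ?K = "Poly_Mapping.keys x" and ?x = "Poly_Mapping.lookup x"
  have "finite (\<Union>\<alpha>\<in>?K. set \<alpha>)" by simp
  then obtain N where N: "\<And>\<alpha> i. \<alpha> \<in> ?K \<Longrightarrow> i \<in> set \<alpha> \<Longrightarrow> i \<le> N"
    unfolding finite_nat_set_iff_bounded_le by blast
  define \<gamma> where "\<gamma> = [Suc N..<Suc N + k]"
  define r where "r = Suc N + k"
  have len: "length \<gamma> = k" and \<gamma>: "\<gamma> \<in> tuples k" by (auto simp: \<gamma>_def tuples_def)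
  have \<gamma>pr: "p # r # \<gamma> \<in> tuples (k + 2)" if "p \<in> {1..N}" for p
    using that by (auto simp: \<gamma>_def r_def tuples_def)
  have K: "length \<alpha> = k" "\<And>i. i < k \<Longrightarrow> \<alpha> ! i \<in> {1..N}" if "\<alpha> \<in> ?K" for \<alpha>
  proof -
    from that x have t: "\<alpha> \<in> tuples k" by blast
    then show l: "length \<alpha> = k" by (simp add: tuples_def)
    show "\<alpha> ! i \<in> {1..N}" if i: "i < k" for i
      using t N[OF \<open>\<alpha> \<in> ?K\<close>] nth_mem[of i \<alpha>] l i by (force simp: tuples_def)
  qed
  define d where "d = (\<Sum>\<alpha>\<in>?K. ?x \<alpha>)"
  define u where "u i p = (\<Sum>\<alpha>\<in>?K. if \<alpha> ! i = p then ?x \<alpha> else 0)" for i p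
  have sum_u: "(\<Sum>p\<in>{1..N}. u i p) = d" if "i < k" for i
  proof -
    have "(\<Sum>p\<in>{1..N}. u i p) = (\<Sum>\<alpha>\<in>?K. \<Sum>p\<in>{1..N}. if \<alpha> ! i = p then ?x \<alpha> else 0)"
      unfolding u_def by (rule sum.swap)
    also have "\<dots> = d"
      unfolding d_def by (intro sum.cong refl) (use K that in auto)
    finally show ?thesis .
  qed
  have rel: "(\<Sum>i<k. int (a ! i) * u i p) = 0" for p
  proof -
    have "0 = Poly_Mapping.lookup (A_pi a x) p" by (simp add: x)
    also have "\<dots> = (\<Sum>\<alpha>\<in>?K. \<Sum>i<k. int (a ! i) * (if \<alpha> ! i = p then ?x \<alpha> else 0))"
      unfolding A_pi_def frag_extend_def lookup_sum lookup_frag_cmul a(1) sum_distrib_left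
      by (intro sum.cong refl) auto
    also have "\<dots> = (\<Sum>i<k. int (a ! i) * u i p)"
      by (subst sum.swap) (simp add: u_def sum_distrib_left)
    finally show ?thesis by simp
  qed
  \<comment> \<open>Adding up the relations over all labels \<open>p\<close> gives the total weight times \<open>d\<close>.\<close>
  have "d = 0"
  proof -
    have "0 = (\<Sum>p\<in>{1..N}. \<Sum>i<k. int (a ! i) * u i p)" by (simp add: rel)
    also have "\<dots> = (\<Sum>i<k. int (a ! i)) * d"
      by (subst sum.swap)
         (simp add: sum_u sum_distrib_right del: One_nat_def flip: sum_distrib_left)
    finally have "(\<Sum>i<k. int (a ! i)) * d = 0" by simp
    moreover have "(\<Sum>i<k. int (a ! i)) > 0"
    proof (rule sum_pos)
      fix i assume "i \<in> {..<k}"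
      then show "int (a ! i) > 0" using a nth_mem[of i a] by fastforce
    qed (use a in \<open>auto simp: lessThan_empty_iff\<close>)
    ultimately show ?thesis by simp
  qed
  define G where "G i p = frag_of (\<gamma>[i := p]) - frag_of (\<gamma>[i := r])" for i p
  define C where "C = frag_of \<gamma> + (\<Sum>i<k. frag_of (\<gamma>[i := r]) - frag_of \<gamma>)"
  have cong: "frag_of \<alpha> - (C + (\<Sum>i<k. G i (\<alpha> ! i))) \<in> H" if "\<alpha> \<in> ?K" for \<alpha>
  proof -
    have "\<alpha> \<in> tuples k" using that x by blast
    moreover have "set \<alpha> \<inter> set \<gamma> = {}" using N[OF that] by (fastforce simp: \<gamma>_def)
    ultimately have "frag_of \<alpha> - (frag_of \<gamma> + (\<Sum>i<k. frag_of (\<gamma>[i := \<alpha> ! i]) - frag_of \<gamma>)) \<in> H"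
      using frag_of_hybrid_congruence[OF H sq] \<gamma> by blast
    then show ?thesis by (simp add: C_def G_def sum_subtractf algebra_simps)
  qed
  have "(\<Sum>\<alpha>\<in>?K. frag_cmul (?x \<alpha>) (frag_of \<alpha> - (C + (\<Sum>i<k. G i (\<alpha> ! i))))) \<in> H"
    by (intro subgroup_sum[OF H] subgroup_frag_cmul[OF H] cong)
  moreover have "(\<Sum>\<alpha>\<in>?K. frag_cmul (?x \<alpha>) (frag_of \<alpha> - (C + (\<Sum>i<k. G i (\<alpha> ! i))))) =
      (\<Sum>\<alpha>\<in>?K. frag_cmul (?x \<alpha>) (frag_of \<alpha>)) - frag_cmul d C
        - (\<Sum>\<alpha>\<in>?K. \<Sum>i<k. frag_cmul (?x \<alpha>) (G i (\<alpha> ! i)))"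
    by (simp add: d_def frag_cmul_sum_left frag_cmul_sum frag_cmul_diff2 frag_cmul_distrib2
                  sum_subtractf sum.distrib)
  moreover have "(\<Sum>\<alpha>\<in>?K. frag_cmul (?x \<alpha>) (frag_of \<alpha>)) = x"
    using frag_expansion[of x] by (simp add: frag_extend_def)
  moreover have "(\<Sum>\<alpha>\<in>?K. \<Sum>i<k. frag_cmul (?x \<alpha>) (G i (\<alpha> ! i))) =
      (\<Sum>p\<in>{1..N}. exchange (\<lambda>i. u i p) \<gamma> p r)"
  proof -
    have "(\<Sum>p\<in>{1..N}. frag_cmul (if \<alpha> ! i = p then ?x \<alpha> else 0) (G i p)) =
        frag_cmul (?x \<alpha>) (G i (\<alpha> ! i))" if "\<alpha> \<in> ?K" "i < k" for \<alpha> i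
    proof -
      have "(\<Sum>p\<in>{1..N}. frag_cmul (if \<alpha> ! i = p then ?x \<alpha> else 0) (G i p)) =
          (\<Sum>p\<in>{1..N}. if \<alpha> ! i = p then frag_cmul (?x \<alpha>) (G i p) else 0)"
        by (intro sum.cong) auto
      then show ?thesis using K[OF that(1)] that(2) by simp
    qed
    then have "(\<Sum>\<alpha>\<in>?K. \<Sum>i<k. frag_cmul (?x \<alpha>) (G i (\<alpha> ! i))) =
        (\<Sum>\<alpha>\<in>?K. \<Sum>i<k. \<Sum>p\<in>{1..N}. frag_cmul (if \<alpha> ! i = p then ?x \<alpha> else 0) (G i p))"
      by (intro sum.cong) auto
    also have "\<dots> = (\<Sum>\<alpha>\<in>?K. \<Sum>p\<in>{1..N}. \<Sum>i<k. frag_cmul (if \<alpha> ! i = p then ?x \<alpha> else 0) (G i p))"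
      by (intro sum.cong refl sum.swap)
    also have "\<dots> = (\<Sum>p\<in>{1..N}. \<Sum>\<alpha>\<in>?K. \<Sum>i<k. frag_cmul (if \<alpha> ! i = p then ?x \<alpha> else 0) (G i p))"
      by (rule sum.swap)
    also have "\<dots> = (\<Sum>p\<in>{1..N}. \<Sum>i<k. \<Sum>\<alpha>\<in>?K. frag_cmul (if \<alpha> ! i = p then ?x \<alpha> else 0) (G i p))"
      by (intro sum.cong refl sum.swap)
    also have "\<dots> = (\<Sum>p\<in>{1..N}. exchange (\<lambda>i. u i p) \<gamma> p r)"
      by (simp add: exchange_def u_def frag_cmul_sum_left len flip: G_def)
    finally show ?thesis .
  qed
  ultimately have "x - (\<Sum>p\<in>{1..N}. exchange (\<lambda>i. u i p) \<gamma> p r) \<in> H"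
    using \<open>d = 0\<close> by simp
  moreover have "(\<Sum>p\<in>{1..N}. exchange (\<lambda>i. u i p) \<gamma> p r) \<in> H"
    by (intro subgroup_sum[OF H] ex \<gamma>pr rel)
  ultimately have "x - (\<Sum>p\<in>{1..N}. exchange (\<lambda>i. u i p) \<gamma> p r) +
      (\<Sum>p\<in>{1..N}. exchange (\<lambda>i. u i p) \<gamma> p r) \<in> H"
    by (rule subgroup_add[OF H])
  then show ?thesis by simp
qed

section \<open>The generating set\<close>

lemma kernel_A_pi:
  "kernel (Lambda k) (free_Abelian_group {1..}) (A_pi a) =
     {x. Poly_Mapping.keys x \<subseteq> tuples k \<and> A_pi a x = 0}"
  by (auto simp: kernel_def Lambda_def)

lemma orbit_subset_kernel:
  assumes "length a = k" "Poly_Mapping.keys v \<subseteq> tuples k" "A_pi a v = 0"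
  shows "orbit_S_inf v \<subseteq> kernel (Lambda k) (free_Abelian_group {1..}) (A_pi a)"
proof
  fix w assume "w \<in> orbit_S_inf v"
  then obtain \<sigma> where \<sigma>: "\<sigma> permutes {1..}" and w: "w = act \<sigma> v"
    by (auto simp: orbit_S_inf_def)
  have "map \<sigma> \<alpha> \<in> tuples k" if "\<alpha> \<in> tuples k" for \<alpha>
    using that permutes_in_image[OF \<sigma>]
    by (auto simp: tuples_def distinct_map intro: inj_on_subset[OF permutes_inj[OF \<sigma>]])
  then have "Poly_Mapping.keys w \<subseteq> tuples k"
    using assms(2) by (auto simp: w keys_act[OF permutes_inj[OF \<sigma>]])
  moreover have "A_pi a w = 0"
    using assms by (simp add: w A_pi_act)
  ultimately show "w \<in> kernel (Lambda k) (free_Abelian_group {1..}) (A_pi a)"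
    unfolding kernel_A_pi by blast
qed

text \<open>
  The generators are placed on the labels \<open>1, \<dots>, k + 2\<close>, with \<open>1\<close> and \<open>2\<close> as the fresh
  labels and \<open>[3..<k + 3]\<close> as the tuple that is modified. The action carries these to any
  other choice of labels.
\<close>

lemma standard_labels_in_tuples: "1 # 2 # [3..<k + 3] \<in> tuples (k + 2)"
  by (auto simp: tuples_def)

lemma orbit_of_standard_labels:
  assumes "p # q # \<gamma> \<in> tuples (k + 2)"
  obtains \<sigma> where "\<sigma> permutes {1..}" "\<sigma> 1 = p" "\<sigma> 2 = q" "map \<sigma> [3..<k + 3] = \<gamma>"
proof -
  have "\<exists>\<sigma>. \<sigma> permutes {1..} \<and> map \<sigma> (1 # 2 # [3..<k + 3]) = p # q # \<gamma>"
    using assms standard_labels_in_tuples[of k]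
    by (intro ex_permutes_map_eq) (auto simp: tuples_def)
  with that show thesis by auto
qed

lemma square_in_orbit:
  assumes "p # q # \<gamma> \<in> tuples (k + 2)"
  shows "square \<gamma> i j p q \<in> orbit_S_inf (square [3..<k + 3] i j 1 2)"
proof -
  from orbit_of_standard_labels[OF assms] obtain \<sigma>
    where "\<sigma> permutes {1..}" "\<sigma> 1 = p" "\<sigma> 2 = q" "map \<sigma> [3..<k + 3] = \<gamma>" .
  then show ?thesis
    unfolding orbit_S_inf_def by (auto simp: act_square intro!: exI[of _ \<sigma>])
qed

lemma exchange_in_orbit:
  assumes "p # q # \<gamma> \<in> tuples (k + 2)"
  shows "exchange c \<gamma> p q \<in> orbit_S_inf (exchange c [3..<k + 3] 1 2)"
proof -
  from orbit_of_standard_labels[OF assms] obtain \<sigma>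
    where "\<sigma> permutes {1..}" "\<sigma> 1 = p" "\<sigma> 2 = q" "map \<sigma> [3..<k + 3] = \<gamma>" .
  then show ?thesis
    unfolding orbit_S_inf_def by (auto simp: act_exchange intro!: exI[of _ \<sigma>])
qed

lemma width_of_standard_labels:
  assumes "Poly_Mapping.keys v \<subseteq> {\<alpha> \<in> tuples k. set \<alpha> \<subseteq> {1, 2} \<union> set [3..<k + 3]}"
    and "{1, 2} \<union> set [3..<k + 3] \<subseteq> (\<Union>\<alpha>\<in>Poly_Mapping.keys v. set \<alpha>)"
  shows "width k v = k + 2"
proof (rule width_eq)
  show "Poly_Mapping.keys v \<subseteq> tuples k" using assms(1) by blast
  have "(\<Union>\<alpha>\<in>Poly_Mapping.keys v. set \<alpha>) = {1, 2} \<union> set [3..<k + 3]"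
    using assms by blast
  also have "\<dots> = {1..k + 2}" by auto
  finally show "(\<Union>\<alpha>\<in>Poly_Mapping.keys v. set \<alpha>) = {1..k + 2}" .
qed

lemma width_square:
  assumes "i < k" "j < k" "i \<noteq> j"
  shows "width k (square [3..<k + 3] i j 1 2) = k + 2"
  using assms
  by (intro width_of_standard_labels keys_square_subset standard_labels_in_tuples labels_square) auto

lemma width_exchange:
  assumes "i < k" "j < k" "i \<noteq> j" "c i \<noteq> 0" "c j \<noteq> 0"
  shows "width k (exchange c [3..<k + 3] 1 2) = k + 2"
  using assms
  by (intro width_of_standard_labels keys_exchange_subset standard_labels_in_tuples
            labels_exchange[of _ _ _ i j]) auto

text \<open>A single nonzero entry would be multiplied by a positive weight and could not be balanced.\<close>

lemma relation_has_two_nonzero_entries: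
  assumes "(\<Sum>i<k. int (a ! i) * c i) = 0" "length a = k" "set a \<subseteq> {1..}" "i < k" "c i \<noteq> 0"
  shows "\<exists>j<k. j \<noteq> i \<and> c j \<noteq> 0"
proof (rule ccontr)
  assume "\<not> ?thesis"
  then have "(\<Sum>j<k. int (a ! j) * c j) = (\<Sum>j<k. if j = i then int (a ! i) * c i else 0)"
    by (intro sum.cong) auto
  with assms have "a ! i = 0" by simp
  with assms nth_mem[of i a] show False by auto
qed

lemma sum_lessThan_id: "2 * (\<Sum>j<k. j) + k = k\<^sup>2" for k :: nat
  by (induction k) (auto simp: power2_eq_square)

theorem corollary2p6:
  fixes k :: nat and a :: "nat list"
  assumes "k \<ge> 1" and "length a = k" and "set a \<subseteq> {1..}"
  shows "\<exists>V. equivariant_lattice_generating_set k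
               (kernel (Lambda k) (free_Abelian_group {1..}) (A_pi a)) V
           \<and> finite V \<and> card V = (k^2 + k - 2) div 2
           \<and> (\<forall>v\<in>V. width k v = k + 2)"
proof -
  let ?L = "kernel (Lambda k) (free_Abelian_group {1..}) (A_pi a)"
  let ?\<gamma> = "[3..<k + 3]"
  have pos: "int (a ! i) > 0" if "i < k" for i
    using assms that nth_mem[of i a] by fastforce
  obtain b :: "nat \<Rightarrow> nat \<Rightarrow> int" where
    b: "\<And>t. t \<in> {1..<k} \<Longrightarrow> b t t \<noteq> 0"
       "\<And>t j. t \<in> {1..<k} \<Longrightarrow> t < j \<Longrightarrow> b t j = 0"
       "\<And>t. t \<in> {1..<k} \<Longrightarrow> (\<Sum>i<k. int (a ! i) * b t i) = 0"
    and gen: "\<And>c. (\<Sum>i<k. int (a ! i) * c i) = 0 \<Longrightarrow>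
                \<exists>n. \<forall>i<k. c i = (\<Sum>t\<in>{1..<k}. n t * b t i)"
    using relation_basis[of k "\<lambda>i. int (a ! i)"] pos by blast
  \<comment> \<open>The pairs of positions are listed with the larger one first, so that their number is \<open>\<Sum>j<k. j\<close>.\<close>
  define Sq where "Sq = (\<lambda>(j, i). square ?\<gamma> i j 1 2) ` (SIGMA j:{..<k}. {..<j})"
  define Ex where "Ex = (\<lambda>t. exchange (b t) ?\<gamma> 1 2) ` {1..<k}"
  have fresh: "1 \<notin> set ?\<gamma>" "2 \<notin> set ?\<gamma>" "(1::nat) \<noteq> 2" "length ?\<gamma> = k" by auto
  have kernel_Sq: "Poly_Mapping.keys v \<subseteq> tuples k \<and> A_pi a v = 0" if "v \<in> Sq" for v
    using that keys_square_subset[OF standard_labels_in_tuples, of k]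
    by (fastforce simp: Sq_def assms intro!: A_pi_square)
  have kernel_Ex: "Poly_Mapping.keys v \<subseteq> tuples k \<and> A_pi a v = 0" if "v \<in> Ex" for v
    using that keys_exchange_subset[OF standard_labels_in_tuples, of _ k] b(3)
    by (fastforce simp: Ex_def assms intro!: A_pi_exchange)
  let ?O = "\<Union>v\<in>Sq \<union> Ex. orbit_S_inf v"
  have grp: "group (Lambda k)" by (simp add: Lambda_def)
  have hom: "group_hom (Lambda k) (free_Abelian_group {1..}) (A_pi a)"
    by (intro group_hom.intro group_hom_axioms.intro grp group_free_Abelian_group A_pi_hom assms)
  have orbits: "?O \<subseteq> ?L"
    using orbit_subset_kernel[OF assms(2)] kernel_Sq kernel_Ex by blast
  have gen_sub: "subgroup (generate (Lambda k) ?O) (free_Abelian_group (tuples k))"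
    using group.generate_is_subgroup[OF grp] orbits
    unfolding Lambda_def kernel_def by blast
  have "generate (Lambda k) ?O = ?L"
  proof
    show "generate (Lambda k) ?O \<subseteq> ?L"
      by (rule group.generate_subgroup_incl[OF grp orbits group_hom.subgroup_kernel[OF hom]])
  next
    show "?L \<subseteq> generate (Lambda k) ?O"
    proof
      fix x assume "x \<in> ?L"
      then have x: "Poly_Mapping.keys x \<subseteq> tuples k" "A_pi a x = 0"
        unfolding kernel_A_pi by blast+
      have sq_less: "square \<gamma> i j p q \<in> generate (Lambda k) ?O"
        if "p # q # \<gamma> \<in> tuples (k + 2)" "i < j" "j < k" for \<gamma> i j p q
      proof (rule generate.incl)
        have "square ?\<gamma> i j 1 2 \<in> Sq" using that by (auto simp: Sq_def)
        then show "square \<gamma> i j p q \<in> ?O" using square_in_orbit[OF that(1)] by blast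
      qed
      have sq: "square \<gamma> i j p q \<in> generate (Lambda k) ?O"
        if "p # q # \<gamma> \<in> tuples (k + 2)" "i < k" "j < k" "i \<noteq> j" for \<gamma> i j p q
      proof (cases "i < j")
        case True
        then show ?thesis using sq_less that by blast
      next
        case False
        moreover have "q # p # \<gamma> \<in> tuples (k + 2)" using that(1) by (auto simp: tuples_def)
        ultimately show ?thesis
          using sq_less[of q p \<gamma> j i] square_commute[of i j \<gamma> q p] that by simp
      qed
      have ex: "exchange c \<gamma> p q \<in> generate (Lambda k) ?O"
        if c: "p # q # \<gamma> \<in> tuples (k + 2)" "(\<Sum>i<k. int (a ! i) * c i) = 0" for c \<gamma> p q
      proof -
        obtain n where "\<And>i. i < k \<Longrightarrow> c i = (\<Sum>t\<in>{1..<k}. n t * b t i)"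
          using gen[OF c(2)] by blast
        then have "exchange c \<gamma> p q = (\<Sum>t\<in>{1..<k}. frag_cmul (n t) (exchange (b t) \<gamma> p q))"
          using tuples_add_2D(2)[OF c(1)] by (intro exchange_sum) auto
        moreover have "exchange (b t) \<gamma> p q \<in> generate (Lambda k) ?O" if "t \<in> {1..<k}" for t
        proof (rule generate.incl)
          have "exchange (b t) ?\<gamma> 1 2 \<in> Ex" using that by (auto simp: Ex_def)
          then show "exchange (b t) \<gamma> p q \<in> ?O" using exchange_in_orbit[OF c(1)] by blast
        qed
        ultimately show ?thesis
          by (simp only: subgroup_sum[OF gen_sub] subgroup_frag_cmul[OF gen_sub])
      qed
      show "x \<in> generate (Lambda k) ?O"
        by (rule kernel_subset_of_squares_and_exchanges[OF assms(2,1,3) gen_sub sq ex x])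
    qed
  qed
  moreover have "Sq \<union> Ex \<subseteq> ?L"
    using kernel_Sq kernel_Ex unfolding kernel_A_pi by blast
  moreover have "card (Sq \<union> Ex) = (k\<^sup>2 + k - 2) div 2"
  proof -
    note lookup_sq = lookup_square[OF fresh(1-3), unfolded fresh(4)]
    note lookup_ex = lookup_exchange[OF fresh(1-3), unfolded fresh(4)]
    \<comment> \<open>A square has coefficient \<open>-1\<close> at \<open>?\<gamma>[l := 1]\<close> only for \<open>l = i\<close>, and at \<open>?\<gamma>[l := 2]\<close> only for \<open>l = j\<close>.\<close>
    have "inj_on (\<lambda>(j, i). square ?\<gamma> i j 1 2) (SIGMA j:{..<k}. {..<j})"
    proof (rule inj_onI; clarify)
      fix j i j' i' assume lt: "j < k" "i < j" "j' < k" "i' < j'"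
        and eq: "square ?\<gamma> i j 1 2 = square ?\<gamma> i' j' 1 2"
      then have k: "i < k" "i' < k" "i \<noteq> j" "i' \<noteq> j'" by auto
      from lookup_sq(2)[OF k(1) lt(1) k(3) k(1)] lookup_sq(2)[OF k(2) lt(3) k(4) k(1)] eq
      have "i = i'" by (simp split: if_splits)
      moreover from lookup_sq(3)[OF k(1) lt(1) k(3) lt(1)] lookup_sq(3)[OF k(2) lt(3) k(4) lt(1)] eq
      have "j = j'" by (simp split: if_splits)
      ultimately show "j = j' \<and> i = i'" by simp
    qed
    then have "card Sq = (\<Sum>j<k. j)"
      unfolding Sq_def by (simp add: card_image)
    moreover have "inj_on (\<lambda>t. exchange (b t) ?\<gamma> 1 2) {1..<k}"
    proof (rule linorder_inj_onI')
      fix s t assume st: "s \<in> {1..<k}" "t \<in> {1..<k}" "s < t"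
      \<comment> \<open>By triangularity \<open>b s t = 0\<close>, whereas \<open>b t t\<close> is nonzero.\<close>
      have "Poly_Mapping.lookup (exchange (b s) ?\<gamma> 1 2) (?\<gamma>[t := 1]) = 0"
        "Poly_Mapping.lookup (exchange (b t) ?\<gamma> 1 2) (?\<gamma>[t := 1]) \<noteq> 0"
        using st b lookup_ex(2) by simp_all
      then show "exchange (b s) ?\<gamma> 1 2 \<noteq> exchange (b t) ?\<gamma> 1 2" by metis
    qed
    then have "card Ex = k - 1"
      unfolding Ex_def by (simp add: card_image)
    \<comment> \<open>The coefficient at the unmodified tuple separates squares from exchanges.\<close>
    moreover have "Sq \<inter> Ex = {}"
    proof -
      have "Poly_Mapping.lookup v ?\<gamma> = 1" if "v \<in> Sq" for v
        using that lookup_sq(1) by (auto simp: Sq_def)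
      moreover have "Poly_Mapping.lookup v ?\<gamma> = 0" if "v \<in> Ex" for v
        using that lookup_ex(1) by (auto simp: Ex_def)
      ultimately show ?thesis by fastforce
    qed
    moreover have "finite Sq" "finite Ex" by (auto simp: Sq_def Ex_def)
    ultimately have "card (Sq \<union> Ex) = (\<Sum>j<k. j) + (k - 1)"
      by (simp add: card_Un_disjoint)
    then show ?thesis using sum_lessThan_id[of k] assms(1) by simp
  qed
  moreover have "width k v = k + 2" if "v \<in> Sq \<union> Ex" for v
  proof -
    have "width k (exchange (b t) ?\<gamma> 1 2) = k + 2" if t: "t \<in> {1..<k}" for t
    proof -
      obtain j where "j < k" "j \<noteq> t" "b t j \<noteq> 0"
        using relation_has_two_nonzero_entries[OF b(3)[OF t] assms(2,3) _ b(1)[OF t]] t by auto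
      then show ?thesis using width_exchange[of j k t "b t"] b(1)[OF t] t by auto
    qed
    then show ?thesis using that width_square by (auto simp: Sq_def Ex_def)
  qed
  moreover have "finite (Sq \<union> Ex)" by (auto simp: Sq_def Ex_def)
  ultimately show ?thesis
    unfolding equivariant_lattice_generating_set_def by blast
qed

end
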